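(* Let $n \in \mathbb{N}$ and let $t, r \in \mathbb{R}$ satisfy $n/2 \le t+1 \le n$, $r \ge 0$, and \[ \binom{\frac n2 - 1}{2} + 3\binom{r}{2} = \binom{t}{2}. \] Define $f:\mathbb{R}\to\mathbb{R}$ by $f(x) = \binom{t}{2} + x(n-x) - \binom{n-x-1}{2}$. If $G$ is an $n$-vertex graph in which each vertex is contained in at least $\binom{t}{2}$ triangles, then \[ e(G) \ge \begin{cases} f(t) & \text{if } r + t \le \frac{5n}{6},\\ f\!\left(\frac n2 + r - 1\right) & \text{otherwise.}\end{cases} \] Furthermore, these bounds are tight when $n/2$, $t$, $r$ are all integers (there is an $n$-vertex graph in which every vertex lies in at least $\binom t2$ triangles with exactly that many edges), and in general they are tight up to an additive $O(n)$ (there is such a graph whose number of edges exceeds the bound by at most $O(n)$).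
   Context: For a real number $x$, $\binom{x}{2} = x(x-1)/2$. $e(G)$ denotes the number of edges of $G$.
   Formalization: The lower bound assumes binom(t,2) > 0 (automatic for n ≥ 5; without it the edgeless graph with n = 2, t = 1, r = 0 violates the bound), and the O(n) tightness is stated for n ≥ 2 (for n = 1, t < 0 no such graph exists). *)

theory Defs
  imports Complex_Main
begin

lemma gchoose_two_real: "(x::real) gchoose 2 = x * (x - 1) / 2"
  by (simp add: gbinomial_prod_rev numeral_2_eq_2)

definition simple_graph :: "'a set \<Rightarrow> 'a set set \<Rightarrow> bool" where
  "simple_graph V E \<longleftrightarrow> finite V \<and> (\<forall>e\<in>E. e \<subseteq> V \<and> card e = 2)"

text \<open>A triangle is represented by its vertex set.\<close>
definition triangles_at :: "'a set set \<Rightarrow> 'a \<Rightarrow> 'a set set" where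
  "triangles_at E v =
     {T. card T = 3 \<and> v \<in> T \<and> (\<forall>x\<in>T. \<forall>y\<in>T. x \<noteq> y \<longrightarrow> {x, y} \<in> E)}"

definition triangle_graph :: "nat \<Rightarrow> real \<Rightarrow> 'a set \<Rightarrow> 'a set set \<Rightarrow> bool" where
  "triangle_graph n t V E \<longleftrightarrow>
     simple_graph V E \<and> card V = n \<and>
     (\<forall>v\<in>V. real (card (triangles_at E v)) \<ge> t gchoose 2)"

definition admissible :: "nat \<Rightarrow> real \<Rightarrow> real \<Rightarrow> bool" where
  "admissible n t r \<longleftrightarrow>
     real n / 2 \<le> t + 1 \<and> t + 1 \<le> real n \<and> r \<ge> 0 \<and>
     ((real n / 2 - 1) gchoose 2) + 3 * (r gchoose 2) = t gchoose 2"

definition edge_fun :: "nat \<Rightarrow> real \<Rightarrow> real \<Rightarrow> real" where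
  "edge_fun n t x = (t gchoose 2) + x * (real n - x) - ((real n - x - 1) gchoose 2)"

definition edge_bound :: "nat \<Rightarrow> real \<Rightarrow> real \<Rightarrow> real" where
  "edge_bound n t r =
     (if r + t \<le> 5 * real n / 6 then edge_fun n t t
      else edge_fun n t (real n / 2 + r - 1))"

end

theory Submission
  imports Defs
begin

text \<open>Let \<open>v\<close> be a vertex of minimum degree \<open>d\<close>; its triangles force \<open>d \<ge> t\<close>. Counting the edges inside
  the neighbourhood of \<open>v\<close> and those meeting its complement gives \<open>e(G) \<ge> f(d)\<close>, and the handshake
  lemma gives \<open>e(G) \<ge> nd/2\<close>. At \<open>b = n/2 + r - 1\<close> the two bounds agree, so for \<open>d \<ge> b\<close> the second one
  yields \<open>e(G) \<ge> f(b)\<close>, while for \<open>t \<le> d \<le> b\<close> concavity of \<open>f\<close> yields \<open>e(G) \<ge> min (f(t)) (f(b))\<close>.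
  The parabola \<open>f\<close> is symmetric about \<open>2n/3 - 1/2\<close>, so \<open>f(t) \<le> f(b)\<close> exactly when \<open>r + t \<le> 5n/6\<close>.

  The value \<open>f(t)\<close> is attained by two cliques of size \<open>t + 1\<close> that together cover the vertices, and
  \<open>f(b)\<close> by two disjoint cliques of size \<open>n/2\<close> joined by an \<open>r\<close>-regular bipartite graph. In general
  \<open>t\<close> and \<open>r\<close> are rounded up, and for odd \<open>n\<close> a universal vertex is added to the second graph.\<close>

section \<open>Triangles as edges inside a neighbourhood\<close>

definition nbrs :: "'a set set \<Rightarrow> 'a \<Rightarrow> 'a set" where
  "nbrs E v = {x. {v, x} \<in> E}"

lemma simple_graph_edgeE:
  assumes "simple_graph V E" "e \<in> E"
  obtains x y where "e = {x, y}" "x \<noteq> y" "x \<in> V" "y \<in> V"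
proof -
  have "e \<subseteq> V" "card e = 2" using assms by (auto simp: simple_graph_def)
  then show thesis using that unfolding card_2_iff by blast
qed

lemma simple_graph_loopless: "simple_graph V E \<Longrightarrow> {x} \<notin> E"
  by (auto simp: simple_graph_def)

lemma finite_edges: "simple_graph V E \<Longrightarrow> finite E"
  unfolding simple_graph_def by (meson Pow_iff finite_Pow_iff finite_subset subsetI)

lemma nbrs_subset: "simple_graph V E \<Longrightarrow> nbrs E v \<subseteq> V"
  unfolding simple_graph_def nbrs_def by auto

lemma finite_nbrs: "simple_graph V E \<Longrightarrow> finite (nbrs E v)"
  using nbrs_subset finite_subset simple_graph_def by metis

lemma not_in_nbrs_self: "simple_graph V E \<Longrightarrow> v \<notin> nbrs E v"
  by (simp add: nbrs_def simple_graph_loopless)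

lemma finite_pairs: "finite A \<Longrightarrow> finite {e. e \<subseteq> A \<and> card e = 2}"
  by simp

text \<open>Deleting \<open>v\<close> from a triangle leaves the opposite edge, whose ends are both
  neighbours of \<open>v\<close>; \<open>insert v\<close> is the inverse map. Triangle counts thus
  become edge counts in a neighbourhood.\<close>

lemma card_triangles_at:
  assumes G: "simple_graph V E"
  shows "card (triangles_at E v) = card {e \<in> E. e \<subseteq> nbrs E v}"
proof -
  have "bij_betw (insert v) {e \<in> E. e \<subseteq> nbrs E v} (triangles_at E v)"
    unfolding bij_betw_def
  proof (intro conjI set_eqI iffI)
    show "inj_on (insert v) {e \<in> E. e \<subseteq> nbrs E v}"
    proof (rule inj_onI)
      fix a b assume ab: "a \<in> {e \<in> E. e \<subseteq> nbrs E v}" "b \<in> {e \<in> E. e \<subseteq> nbrs E v}"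
        and eq: "insert v a = insert v b"
      have "v \<notin> a" "v \<notin> b" using ab not_in_nbrs_self[OF G, of v] by auto
      then show "a = b" using eq by (simp add: insert_ident)
    qed
  next
    fix T assume "T \<in> insert v ` {e \<in> E. e \<subseteq> nbrs E v}"
    then obtain e where e: "e \<in> E" "e \<subseteq> nbrs E v" "T = insert v e" by auto
    obtain x y where xy: "e = {x, y}" "x \<noteq> y" using simple_graph_edgeE[OF G e(1)] by metis
    have "v \<notin> e" using e not_in_nbrs_self[OF G, of v] by blast
    then have "v \<noteq> x" "v \<noteq> y" using xy by auto
    moreover have "{v, x} \<in> E" "{v, y} \<in> E" using e xy by (auto simp: nbrs_def)
    ultimately show "T \<in> triangles_at E v"
      using e xy unfolding triangles_at_def by (auto simp: insert_commute)
  next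
    fix T assume T: "T \<in> triangles_at E v"
    then have "card (T - {v}) = 2" by (simp add: triangles_at_def)
    then obtain x y where xy: "T - {v} = {x, y}" "x \<noteq> y" unfolding card_2_iff by metis
    then have m: "x \<in> T" "y \<in> T" "v \<in> T" "x \<noteq> v" "y \<noteq> v" using T by (auto simp: triangles_at_def)
    have "{x, y} \<in> E" "{v, x} \<in> E" "{v, y} \<in> E"
      using m T \<open>x \<noteq> y\<close> unfolding triangles_at_def by auto
    moreover have "T = insert v {x, y}" using xy m by blast
    ultimately show "T \<in> insert v ` {e \<in> E. e \<subseteq> nbrs E v}" by (auto simp: nbrs_def)
  qed
  then show ?thesis by (simp add: bij_betw_same_card)
qed

lemma triangles_le_choose_degree:
  assumes G: "simple_graph V E"
  shows "card (triangles_at E v) \<le> card (nbrs E v) choose 2"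
proof -
  have "{e \<in> E. e \<subseteq> nbrs E v} \<subseteq> {e. e \<subseteq> nbrs E v \<and> card e = 2}"
    using G by (auto simp: simple_graph_def)
  then show ?thesis
    using card_mono[OF finite_pairs[OF finite_nbrs[OF G]]] n_subsets[OF finite_nbrs[OF G]]
    by (simp add: card_triangles_at[OF G])
qed

lemma card_incident_edges:
  assumes G: "simple_graph V E"
  shows "card {e \<in> E. v \<in> e} = card (nbrs E v)"
proof -
  have "bij_betw (\<lambda>x. {v, x}) (nbrs E v) {e \<in> E. v \<in> e}"
    unfolding bij_betw_def
  proof (intro conjI set_eqI iffI)
    show "inj_on (\<lambda>x. {v, x}) (nbrs E v)" by (auto simp: inj_on_def doubleton_eq_iff)
  next
    fix e assume e: "e \<in> {e \<in> E. v \<in> e}"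
    then obtain x y where "e = {x, y}" using simple_graph_edgeE[OF G] by blast
    with e show "e \<in> (\<lambda>x. {v, x}) ` nbrs E v"
      by (auto simp: nbrs_def image_iff insert_commute)
  qed (auto simp: nbrs_def)
  then show ?thesis by (simp add: bij_betw_same_card)
qed

text \<open>Double counting of incident pairs of a vertex and an edge. With \<open>W = V\<close>
  this is the handshake lemma; the general \<open>W\<close> serves the count over the non-neighbours
  of a vertex.\<close>

lemma sum_degrees:
  assumes G: "simple_graph V E" and W: "W \<subseteq> V"
  shows "(\<Sum>w\<in>W. card (nbrs E w)) = (\<Sum>e\<in>E. card (e \<inter> W))"
proof -
  have fin: "finite W" "finite E"
    using G W finite_edges finite_subset by (auto simp: simple_graph_def)
  have "(\<Sum>w\<in>W. card (nbrs E w)) = (\<Sum>w\<in>W. card {e \<in> E. w \<in> e})"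
    using card_incident_edges[OF G] by simp
  also have "\<dots> = (\<Sum>w\<in>W. \<Sum>e\<in>E. if w \<in> e then 1 else 0)"
    by (simp add: sum.inter_filter[symmetric] fin)
  also have "\<dots> = (\<Sum>e\<in>E. \<Sum>w\<in>W. if w \<in> e then 1 else 0)" by (rule sum.swap)
  also have "\<dots> = (\<Sum>e\<in>E. card {w \<in> W. w \<in> e})"
    by (simp add: sum.inter_filter[symmetric] fin)
  also have "\<dots> = (\<Sum>e\<in>E. card (e \<inter> W))"
    by (intro sum.cong refl arg_cong[where f = card]) auto
  finally show ?thesis .
qed

section \<open>The lower bound\<close>

lemma edges_ge_half_min_degree:
  assumes G: "simple_graph V E" and d: "\<And>v. v \<in> V \<Longrightarrow> d \<le> card (nbrs E v)"
  shows "card V * d \<le> 2 * card E"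
proof -
  have "card V * d \<le> (\<Sum>w\<in>V. card (nbrs E w))"
    using sum_mono[of V "\<lambda>_. d", OF d] by simp
  also have "\<dots> = (\<Sum>e\<in>E. card (e \<inter> V))" by (rule sum_degrees[OF G order_refl])
  also have "\<dots> = (\<Sum>e\<in>E. 2)"
    using G by (intro sum.cong refl) (auto simp: simple_graph_def Int_absorb2)
  finally show ?thesis by simp
qed

text \<open>Edges outside the neighbourhood of \<open>v\<close> meet \<open>W = V - nbrs E v\<close>. Summing degrees over \<open>W\<close>
  counts them once, or twice when they lie inside \<open>W\<close>, where \<open>v\<close> itself is isolated.\<close>
lemma edges_ge_triangles_min_degree:
  assumes G: "simple_graph V E" and d: "\<And>w. w \<in> V \<Longrightarrow> d \<le> card (nbrs E w)" and v: "v \<in> V"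
  shows "card (triangles_at E v) + (card V - card (nbrs E v)) * d
           \<le> card E + (card V - card (nbrs E v) - 1 choose 2)"
proof -
  define N W where "N = nbrs E v" and "W = V - N"
  have fV: "finite V" and fE: "finite E" using G finite_edges by (auto simp: simple_graph_def)
  have NV: "N \<subseteq> V" and vN: "v \<notin> N" using nbrs_subset[OF G] not_in_nbrs_self[OF G] by (auto simp: N_def)
  have fW: "finite W" using fV by (simp add: W_def)
  have cW: "card W = card V - card N"
    using NV fV by (simp add: W_def card_Diff_subset finite_subset)
  have vW: "v \<in> W" using v vN by (simp add: W_def)
  have le: "card (e \<inter> W) \<le> (if \<not> e \<subseteq> N then 1 else 0) + (if e \<subseteq> W - {v} then 1 else 0)"
    if e: "e \<in> E" for e
  proof -
    obtain x y where xy: "e = {x, y}" "x \<noteq> y" "x \<in> V" "y \<in> V"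
      using simple_graph_edgeE[OF G e] by metis
    have v': "x = v \<Longrightarrow> y \<in> N" "y = v \<Longrightarrow> x \<in> N"
      using e xy by (auto simp: N_def nbrs_def insert_commute)
    show ?thesis
    proof (cases "x \<in> W")
      case xW: True
      show ?thesis
      proof (cases "y \<in> W")
        case True
        then have "e \<subseteq> W - {v}" "\<not> e \<subseteq> N" using xW v' xy by (auto simp: W_def)
        moreover have "card (e \<inter> W) \<le> 2" using xy True xW by auto
        ultimately show ?thesis by simp
      next
        case False
        then have "e \<inter> W = {x}" "\<not> e \<subseteq> N" using xW xy by (auto simp: W_def)
        then show ?thesis by simp
      qed
    next
      case xW: False
      show ?thesis
      proof (cases "y \<in> W")
        case True
        then have "e \<inter> W = {y}" "\<not> e \<subseteq> N" using xW xy by (auto simp: W_def)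
        then show ?thesis by simp
      next
        case False
        then have "e \<inter> W = {}" using xW xy by auto
        then show ?thesis by simp
      qed
    qed
  qed
  have "card W * d \<le> (\<Sum>w\<in>W. card (nbrs E w))"
    using sum_mono[of W "\<lambda>_. d"] d by (simp add: W_def)
  also have "\<dots> = (\<Sum>e\<in>E. card (e \<inter> W))" by (rule sum_degrees[OF G]) (auto simp: W_def)
  also have "\<dots> \<le> (\<Sum>e\<in>E. (if \<not> e \<subseteq> N then 1 else 0) + (if e \<subseteq> W - {v} then 1 else 0))"
    using le by (rule sum_mono)
  also have "\<dots> = card {e \<in> E. \<not> e \<subseteq> N} + card {e \<in> E. e \<subseteq> W - {v}}"
    unfolding sum.distrib by (simp only: sum.inter_filter[symmetric] fE) simp
  also have "card {e \<in> E. e \<subseteq> W - {v}} \<le> card {e. e \<subseteq> W - {v} \<and> card e = 2}"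
    using G by (intro card_mono finite_pairs) (auto simp: simple_graph_def fW)
  also have "\<dots> = (card V - card N - 1 choose 2)"
    using fW vW by (simp add: n_subsets cW)
  finally have "card W * d \<le> card {e \<in> E. \<not> e \<subseteq> N} + (card V - card N - 1 choose 2)" by simp
  \<comment> \<open>The edges inside \<open>N\<close> are as many as the triangles at
    \<open>v\<close>, so adding them to the edges meeting \<open>W\<close> accounts for all of
    \<open>E\<close>.\<close>
  moreover have "card E = card {e \<in> E. e \<subseteq> N} + card {e \<in> E. \<not> e \<subseteq> N}"
    using fE by (subst card_Un_disjoint[symmetric]) (auto intro!: arg_cong[where f = card])
  ultimately show ?thesis
    using card_triangles_at[OF G, of v] by (simp add: cW N_def)
qed

section \<open>Real-variable inequalities for the two candidate bounds\<close>

lemma gchoose_two_mono: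
  fixes x y :: real
  assumes "1 / 2 \<le> x" "x \<le> y"
  shows "x gchoose 2 \<le> y gchoose 2"
proof -
  have "0 \<le> (y - x) * (y + x - 1)" using assms by simp
  then show ?thesis by (simp add: gchoose_two_real field_simps)
qed

lemma gchoose_two_less:
  fixes x y :: real
  assumes "1 / 2 \<le> x" "x < y"
  shows "x gchoose 2 < y gchoose 2"
proof -
  have "0 < (y - x) * (y + x - 1)" using assms by simp
  then show ?thesis by (simp add: gchoose_two_real field_simps)
qed

text \<open>The parabola x(x-1)/2 has its minimum at 1/2, so monotonicity fails below that. For
  \<open>x \<le> 1\<close> the left side is at most 0, while a binomial of a natural number is
  nonnegative.\<close>

lemma gchoose_two_le_nat:
  fixes x :: real
  assumes "0 \<le> x" "x \<le> real k"
  shows "x gchoose 2 \<le> real k gchoose 2"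
proof (cases "x \<le> 1")
  case True
  then have "x gchoose 2 \<le> 0"
    using assms by (simp add: gchoose_two_real mult_nonneg_nonpos)
  also have "0 \<le> real (k choose 2)" by simp
  finally show ?thesis by (simp add: binomial_gbinomial)
next
  case False
  then show ?thesis using assms by (intro gchoose_two_mono) auto
qed

text \<open>At \<open>r\<close> = n/2 the left side of the defining equation already equals the
  binomial of n-1, the largest value open to \<open>t gchoose 2\<close>. This later guarantees room
  for an \<open>r\<close>-regular bipartite graph.\<close>

lemma admissible_r_le_half:
  assumes "admissible n t r" "n \<ge> 2"
  shows "r \<le> real n / 2"
proof (rule ccontr)
  assume "\<not> r \<le> real n / 2"
  then have "(real n / 2) gchoose 2 < r gchoose 2"
    using assms by (intro gchoose_two_less) auto
  moreover have "t gchoose 2 \<le> real (n - 1) gchoose 2"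
    using assms by (intro gchoose_two_le_nat) (auto simp: admissible_def of_nat_diff)
  moreover have "((real n / 2 - 1) gchoose 2) + 3 * ((real n / 2) gchoose 2) = real (n - 1) gchoose 2"
    using assms by (simp add: gchoose_two_real of_nat_diff field_simps)
  ultimately show False using assms by (simp add: admissible_def)
qed

text \<open>The defining equation eliminates \<open>t\<close>; what remains is nb/2 for b = n/2 + r
  - 1, the edge count of a b-regular graph.\<close>

lemma edge_fun_regular:
  assumes "admissible n t r"
  shows "edge_fun n t (real n / 2 + r - 1) = real n / 2 * (real n / 2 + r - 1)"
proof -
  have t: "t gchoose 2 = ((real n / 2 - 1) gchoose 2) + 3 * (r gchoose 2)"
    using assms by (simp add: admissible_def)
  show ?thesis unfolding edge_fun_def t unfolding gchoose_two_real by (simp add: field_simps)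
qed

text \<open>As a function of its last argument \<open>edge_fun\<close> is quadratic with leading
  coefficient -3/2 and axis 2n/3 - 1/2. The last factor is twice the axis minus x + y, so signs can
  be read off.\<close>

lemma edge_fun_diff:
  "edge_fun n t y - edge_fun n t x = 3 / 2 * (y - x) * (4 * real n / 3 - 1 - x - y)"
  unfolding edge_fun_def gchoose_two_real by (simp add: field_simps)

lemma edge_bound_le:
  assumes "admissible n t r" "t \<le> d" "t \<le> real n / 2 + r - 1"
    and F: "edge_fun n t d \<le> e" and D: "real n * d / 2 \<le> e"
  shows "edge_bound n t r \<le> e"
proof -
  define b where "b = real n / 2 + r - 1"
  \<comment> \<open>Since t + b = n/2 + r + t - 1, the right-hand expression is 5n/6 - r -
    t.\<close>
  have sgn: "r + t \<le> 5 * real n / 6 \<longleftrightarrow> 0 \<le> 4 * real n / 3 - 1 - t - b"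
    by (auto simp: b_def field_simps)
  have tb: "t \<le> b" using assms by (simp add: b_def)
  have fb: "edge_fun n t b = real n * b / 2" using edge_fun_regular[OF assms(1)] by (simp add: b_def)
  have dtb: "edge_fun n t b - edge_fun n t t = 3 / 2 * (b - t) * (4 * real n / 3 - 1 - t - b)"
    by (rule edge_fun_diff)
  have bound: "edge_bound n t r \<le> edge_fun n t t \<and> edge_bound n t r \<le> edge_fun n t b"
  proof (cases "r + t \<le> 5 * real n / 6")
    case True
    then have "0 \<le> 3 / 2 * (b - t) * (4 * real n / 3 - 1 - t - b)" using sgn tb by simp
    then show ?thesis using dtb True by (simp add: edge_bound_def)
  next
    case False
    then have "3 / 2 * (b - t) * (4 * real n / 3 - 1 - t - b) \<le> 0"
      using sgn tb by (intro mult_nonneg_nonpos) auto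
    then show ?thesis using dtb False by (simp add: edge_bound_def b_def)
  qed
  show ?thesis
  proof (cases "d \<le> b")
    case False
    then have "real n * b / 2 \<le> real n * d / 2" by (simp add: mult_left_mono)
    then show ?thesis using bound fb D by linarith
  next
    case True
    show ?thesis
    \<comment> \<open>The sign tells whether f(d) is at least f(t). If it is negative,
      \<open>t \<le> d\<close> puts \<open>d\<close> beyond the axis, where f decreases, so f(d) is
      at least f(b).\<close>
    proof (cases "4 * real n / 3 - 1 - t - d \<ge> 0")
      case True
      then have "0 \<le> edge_fun n t d - edge_fun n t t"
        unfolding edge_fun_diff using assms by simp
      then show ?thesis using bound F by linarith
    next
      case False
      then have "0 \<le> (b - d) * - (4 * real n / 3 - 1 - d - b)"
        using \<open>d \<le> b\<close> tb by (intro mult_nonneg_nonneg) auto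
      moreover have "edge_fun n t b - edge_fun n t d = - (3 / 2 * ((b - d) * - (4 * real n / 3 - 1 - d - b)))"
        unfolding edge_fun_diff by (simp only: mult_minus_right minus_minus mult.assoc)
      ultimately show ?thesis using bound F by linarith
    qed
  qed
qed

text \<open>The binomial of m + r - 1 exceeds \<open>t gchoose 2\<close> by exactly r(m - r), which
  is nonnegative because \<open>r\<close> is at most m = n/2.\<close>

lemma admissible_t_le_regular_degree:
  assumes adm: "admissible n t r" and n: "n \<ge> 3"
  shows "t \<le> real n / 2 + r - 1"
proof (rule ccontr)
  define m where "m = real n / 2"
  assume "\<not> ?thesis"
  then have less: "m + r - 1 < t" by (simp add: m_def)
  have m: "3 / 2 \<le> m" "m - 1 \<le> t" "0 \<le> r" and
    eq: "((m - 1) gchoose 2) + 3 * (r gchoose 2) = t gchoose 2"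
    using adm n by (auto simp: m_def admissible_def)
  have rm: "r \<le> m" using admissible_r_le_half[OF adm] n by (simp add: m_def)
  have "(m + r - 1) gchoose 2 < t gchoose 2" using less m by (intro gchoose_two_less) auto
  moreover have "((m + r - 1) gchoose 2) - (((m - 1) gchoose 2) + 3 * (r gchoose 2)) = r * (m - r)"
    by (simp add: gchoose_two_real field_simps)
  moreover have "0 \<le> r * (m - r)" using m rm by simp
  ultimately show False using eq by linarith
qed

text \<open>For n = 0 the only value is \<open>t = -1\<close>, where \<open>t gchoose 2\<close>
  equals 1. Positivity of the binomial therefore does not exclude this case, and it is treated
  apart.\<close>

lemma edge_bound_0:
  assumes adm: "admissible 0 t r"
  shows "edge_bound 0 t r = 0"
proof -
  have t: "t = -1" using adm by (simp add: admissible_def)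
  then have "r * (r - 1) = 0" using adm by (simp add: admissible_def gchoose_two_real)
  then have "r = 0 \<or> r = 1" by simp
  then show ?thesis using t by (auto simp: edge_bound_def edge_fun_def gchoose_two_real)
qed

lemma triangle_graph_edges_ge:
  assumes adm: "admissible n t r" and pos: "0 < (t gchoose 2)" and T: "triangle_graph n t V E"
  shows "edge_bound n t r \<le> real (card E)"
proof (cases "n = 0")
  case True
  then have "edge_bound n t r = 0" using edge_bound_0 adm by simp
  then show ?thesis by simp
next
  case False
  have G: "simple_graph V E" and cV: "card V = n"
    and tri: "\<And>v. v \<in> V \<Longrightarrow> t gchoose 2 \<le> real (card (triangles_at E v))"
    using T by (auto simp: triangle_graph_def)
  have fV: "finite V" and ne: "V \<noteq> {}" using cV False G by (auto simp: simple_graph_def)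
  have lt: "card (nbrs E v) < n" if "v \<in> V" for v
  proof -
    have "nbrs E v \<subset> V" using nbrs_subset[OF G] not_in_nbrs_self[OF G] that by blast
    then show ?thesis using psubset_card_mono[OF fV] cV by blast
  qed
  have choose: "t gchoose 2 \<le> real (card (nbrs E v)) gchoose 2" if "v \<in> V" for v
  proof -
    have "real (card (triangles_at E v)) \<le> real (card (nbrs E v) choose 2)"
      using triangles_le_choose_degree[OF G] by (rule of_nat_mono)
    then show ?thesis using tri[OF that] by (simp only: binomial_gbinomial)
  qed
  define d where "d = Min ((\<lambda>v. card (nbrs E v)) ` V)"
  have "d \<in> (\<lambda>v. card (nbrs E v)) ` V" unfolding d_def using fV ne by (intro Min_in) auto
  then obtain v where v: "v \<in> V" "card (nbrs E v) = d" by blast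
  have dmin: "d \<le> card (nbrs E w)" if "w \<in> V" for w
    unfolding d_def using that fV by (intro Min_le) auto
  have dn: "d < n" using lt[OF v(1)] v(2) by simp
  \<comment> \<open>Positivity forces \<open>d \<ge> 2\<close>. This gives \<open>n \<ge> 3\<close>
    and places \<open>d\<close> on the increasing branch of the binomial, so that comparing
    binomials yields \<open>t \<le> d\<close>.\<close>
  have "0 < real (d choose 2)"
    using choose[OF v(1)] pos unfolding v(2) binomial_gbinomial by linarith
  then have d2: "d \<ge> 2" by (metis binomial_eq_0 not_less of_nat_0 order_less_irrefl)
  have n3: "n \<ge> 3" using d2 dn by simp
  have td: "t \<le> real d"
  proof (rule ccontr)
    assume "\<not> t \<le> real d"
    then have "real d gchoose 2 < t gchoose 2" using d2 by (intro gchoose_two_less) auto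
    then show False using choose[OF v(1)] v(2) by simp
  qed
  have nd: "real (n - d) = real n - d" "real (n - d - 1) = real n - d - 1"
    using dn by (simp_all add: of_nat_diff Suc_leI)
  have "real (card (triangles_at E v) + (n - d) * d) \<le> real (card E + (n - d - 1 choose 2))"
    using edges_ge_triangles_min_degree[OF G dmin v(1)] unfolding v(2) cV by (rule of_nat_mono)
  then have "real (card (triangles_at E v)) + (real n - d) * d \<le> card E + ((real n - d - 1) gchoose 2)"
    unfolding of_nat_add of_nat_mult binomial_gbinomial nd .
  then have F: "edge_fun n t d \<le> card E"
    using tri[OF v(1)] unfolding edge_fun_def mult.commute[of "real d"] by linarith
  have "real (n * d) \<le> real (2 * card E)"
    using edges_ge_half_min_degree[OF G dmin] unfolding cV by (rule of_nat_mono)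
  then have "real n * real d / 2 \<le> real (card E)" by (simp only: of_nat_mult of_nat_numeral)
  with edge_bound_le[OF adm td admissible_t_le_regular_degree[OF adm n3] F] show ?thesis .
qed

section \<open>Two overlapping cliques\<close>

lemma clique_triangles:
  assumes G: "simple_graph V E" and A: "finite A" "{e. e \<subseteq> A \<and> card e = 2} \<subseteq> E" and v: "v \<in> A"
  shows "card A - 1 choose 2 \<le> card (triangles_at E v)"
proof -
  have "{e. e \<subseteq> A - {v} \<and> card e = 2} \<subseteq> {e \<in> E. e \<subseteq> nbrs E v}"
  proof
    fix e assume e: "e \<in> {e. e \<subseteq> A - {v} \<and> card e = 2}"
    then have "e \<in> E" using A(2) by blast
    moreover have "x \<in> nbrs E v" if "x \<in> e" for x
    proof -
      have "x \<in> A" "v \<noteq> x" using e that by auto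
      then have "{v, x} \<subseteq> A \<and> card {v, x} = 2" using v by simp
      then have "{v, x} \<in> E" using A(2) by blast
      then show ?thesis by (simp add: nbrs_def)
    qed
    ultimately show "e \<in> {e \<in> E. e \<subseteq> nbrs E v}" by blast
  qed
  then have "card {e. e \<subseteq> A - {v} \<and> card e = 2} \<le> card {e \<in> E. e \<subseteq> nbrs E v}"
    using finite_edges[OF G] by (intro card_mono) auto
  then show ?thesis using A(1) v by (simp add: n_subsets card_triangles_at[OF G])
qed

text \<open>The cliques occupy the first and the last k + 1 of n vertices and overlap in 2(k + 1) -
  n of them; inclusion-exclusion counts the edges. For k = n - 1 both are the complete
  graph.\<close>

lemma overlapping_cliques:
  assumes k: "n \<le> 2 * (k + 1)" "k + 1 \<le> n" and t: "t gchoose 2 \<le> real k gchoose 2"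
  shows "\<exists>(V :: nat set) E. triangle_graph n t V E \<and> real (card E) = edge_fun n k k"
proof -
  define A B where "A = {..<k + 1}" and "B = {n - (k + 1)..<n}"
  define P where "P S = {e. e \<subseteq> S \<and> card e = 2}" for S :: "nat set"
  have cA: "card A = k + 1" "finite A" and cB: "card B = k + 1" "finite B"
    using k by (auto simp: A_def B_def)
  have "A \<inter> B = {n - (k + 1)..<k + 1}" using k by (auto simp: A_def B_def)
  then have cAB: "card (A \<inter> B) = 2 * (k + 1) - n" using k by simp
  have "A \<subseteq> {..<n}" "B \<subseteq> {..<n}" using k by (auto simp: A_def B_def)
  then have G: "simple_graph {..<n} (P A \<union> P B)"
    unfolding simple_graph_def P_def by blast
  have "t gchoose 2 \<le> card (triangles_at (P A \<union> P B) v)" if "v < n" for v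
  proof -
    have "v \<in> A \<or> v \<in> B" using that k by (auto simp: A_def B_def)
    then have "k choose 2 \<le> card (triangles_at (P A \<union> P B) v)"
      using clique_triangles[OF G cA(2), of v] clique_triangles[OF G cB(2), of v] cA cB
      by (auto simp: P_def)
    then have "real (k choose 2) \<le> card (triangles_at (P A \<union> P B) v)" by simp
    then show ?thesis using t by (simp add: binomial_gbinomial)
  qed
  then have tri: "triangle_graph n t {..<n} (P A \<union> P B)"
    using G by (simp add: triangle_graph_def)
  have cP: "finite (P S)" "card (P S) = (card S choose 2)" if "finite S" for S
    using that by (simp_all add: P_def n_subsets)
  have "P A \<inter> P B = P (A \<inter> B)" unfolding P_def by blast
  then have "card (P A \<union> P B) + (2 * (k + 1) - n choose 2) = (k + 1 choose 2) + (k + 1 choose 2)"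
    using card_Un_Int[of "P A" "P B"] cP[of A] cP[of B] cP[of "A \<inter> B"] cA cB cAB by simp
  then have "real (card (P A \<union> P B)) + real (2 * (k + 1) - n choose 2)
      = real (k + 1 choose 2) + real (k + 1 choose 2)"
    by (metis of_nat_add)
  then have "real (card (P A \<union> P B)) = edge_fun n k k"
    using k by (simp add: binomial_gbinomial of_nat_diff gchoose_two_real edge_fun_def field_simps)
  then show ?thesis using tri by blast
qed

section \<open>Two disjoint cliques joined by a regular bipartite graph\<close>

text \<open>Cross edges are stored as ordered pairs, so \<open>P\<close> and its converse give the
  cross neighbours of either side as relational images.\<close>

definition two_cliques :: "'a set \<Rightarrow> 'a set \<Rightarrow> ('a \<times> 'a) set \<Rightarrow> 'a set set" where
  "two_cliques A B P = {e. e \<subseteq> A \<and> card e = 2} \<union> {e. e \<subseteq> B \<and> card e = 2} \<union> (\<lambda>(x, y). {x, y}) ` P"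

text \<open>This symmetry transfers statements about vertices of \<open>A\<close> to vertices of
  \<open>B\<close>.\<close>

lemma two_cliques_swap: "two_cliques B A (P\<inverse>) = two_cliques A B P"
proof -
  have "(\<lambda>(x, y). {x, y}) ` (P\<inverse>) = (\<lambda>(x, y). {x, y}) ` P"
    by (force simp: image_iff insert_commute)
  then show ?thesis unfolding two_cliques_def by blast
qed

lemma simple_graph_two_cliques:
  assumes "finite A" "finite B" "A \<inter> B = {}" "P \<subseteq> A \<times> B"
  shows "simple_graph (A \<union> B) (two_cliques A B P)"
proof -
  have "\<forall>(x, y)\<in>P. x \<in> A \<and> y \<in> B \<and> x \<noteq> y" using assms by blast
  then show ?thesis using assms unfolding simple_graph_def two_cliques_def by fastforce
qed

lemma inj_on_doubleton:
  assumes "A \<inter> B = {}" "P \<subseteq> A \<times> B"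
  shows "inj_on (\<lambda>(x, y). {x, y}) P"
  using assms by (fastforce simp: inj_on_def doubleton_eq_iff)

lemma card_two_cliques:
  assumes AB: "finite A" "finite B" "A \<inter> B = {}" and P: "P \<subseteq> A \<times> B"
  shows "card (two_cliques A B P) = (card A choose 2) + (card B choose 2) + card P"
proof -
  define Q where "Q = (\<lambda>(x, y). {x, y}) ` P"
  have fP: "finite P" using AB P finite_subset by blast
  have cQ: "card Q = card P" "finite Q"
    unfolding Q_def using card_image[OF inj_on_doubleton[OF AB(3) P]] fP by auto
  have "{e. e \<subseteq> A \<and> card e = 2} \<inter> {e. e \<subseteq> B \<and> card e = 2} = {}"
    using AB(3) by (auto simp: card_2_iff)
  moreover have "({e. e \<subseteq> A \<and> card e = 2} \<union> {e. e \<subseteq> B \<and> card e = 2}) \<inter> Q = {}"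
    using AB(3) P by (auto simp: Q_def)
  ultimately show ?thesis
    using AB cQ unfolding two_cliques_def Q_def[symmetric]
    by (simp add: card_Un_disjoint n_subsets)
qed

lemma two_cliques_nbrs_left:
  assumes "v \<in> A" "A \<inter> B = {}" "P \<subseteq> A \<times> B"
  shows "(A - {v}) \<union> P `` {v} \<subseteq> nbrs (two_cliques A B P) v"
  using assms unfolding nbrs_def two_cliques_def by auto

text \<open>The neighbourhood of \<open>v\<close> again contains two cliques, \<open>A - {v}\<close>
  and the \<open>r\<close> cross neighbours of \<open>v\<close>. Each of the latter has r - 1 cross
  edges to \<open>A - {v}\<close>. As r(r-1) is twice \<open>r choose 2\<close>, this explains the
  factor 3 in the equation defining \<open>r\<close>.\<close>

lemma two_cliques_triangles_left:
  assumes AB: "finite A" "finite B" "A \<inter> B = {}" and P: "P \<subseteq> A \<times> B"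
    and v: "v \<in> A" and r: "card (P `` {v}) = r" "\<And>y. y \<in> B \<Longrightarrow> card (P\<inverse> `` {y}) = r"
  shows "(card A - 1 choose 2) + (r choose 2) + r * (r - 1) \<le> card (triangles_at (two_cliques A B P) v)"
proof -
  define S where "S = P `` {v}"
  define Q where "Q = P \<inter> ((A - {v}) \<times> S)"
  have S: "S \<subseteq> B" "finite S" using P AB finite_subset[of S B] by (auto simp: S_def)
  have G: "simple_graph (A \<union> B) (two_cliques A B P)" using simple_graph_two_cliques[OF AB P] .
  have "card (Q\<inverse> `` {y}) = r - 1" if "y \<in> S" for y
  proof -
    have "Q\<inverse> `` {y} = P\<inverse> `` {y} - {v}" using that P by (auto simp: Q_def)
    moreover have "v \<in> P\<inverse> `` {y}" "finite (P\<inverse> `` {y})"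
      using that P AB finite_subset[of "P\<inverse> `` {y}" A] by (auto simp: S_def)
    ultimately show ?thesis using r(2) that S by auto
  qed
  moreover have "card (Q\<inverse>) = (\<Sum>y\<in>S. card (Q\<inverse> `` {y}))"
  proof -
    have "finite (Q\<inverse> `` {y})" for y
      using AB by (auto intro!: finite_subset[of _ A] simp: Q_def)
    then have "card (SIGMA y:S. Q\<inverse> `` {y}) = (\<Sum>y\<in>S. card (Q\<inverse> `` {y}))"
      using S by (intro card_SigmaI) auto
    moreover have "(SIGMA y:S. Q\<inverse> `` {y}) = Q\<inverse>" by (auto simp: Q_def)
    ultimately show ?thesis by simp
  qed
  ultimately have "card (Q\<inverse>) = r * (r - 1)" using r by (simp add: S_def)
  then have cQ: "card Q = r * (r - 1)" by simp
  have "two_cliques (A - {v}) S Q \<subseteq> {e \<in> two_cliques A B P. e \<subseteq> nbrs (two_cliques A B P) v}"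
  proof -
    have "two_cliques (A - {v}) S Q \<subseteq> two_cliques A B P"
      using S by (auto simp: two_cliques_def Q_def)
    moreover have "e \<subseteq> (A - {v}) \<union> S" if "e \<in> two_cliques (A - {v}) S Q" for e
      using that by (auto simp: two_cliques_def Q_def)
    ultimately show ?thesis using two_cliques_nbrs_left[OF v AB(3) P] unfolding S_def by blast
  qed
  then have "card (two_cliques (A - {v}) S Q) \<le> card {e \<in> two_cliques A B P. e \<subseteq> nbrs (two_cliques A B P) v}"
    using finite_edges[OF G] by (intro card_mono) auto
  moreover have "card (two_cliques (A - {v}) S Q) = (card A - 1 choose 2) + (r choose 2) + r * (r - 1)"
    using AB S v cQ r by (subst card_two_cliques) (auto simp: Q_def S_def)
  ultimately show ?thesis by (simp add: card_triangles_at[OF G])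
qed

text \<open>A circulant construction: x and y are joined when y - x lies in one of \<open>r\<close>
  fixed residue classes modulo \<open>m\<close>. With one end fixed, the other runs through
  \<open>m\<close> consecutive integers and meets every class once.\<close>

lemma regular_bipartite_exists:
  fixes m r :: nat
  assumes "r \<le> m"
  obtains P where "P \<subseteq> {..<m} \<times> {m..<2 * m}"
    "\<And>x. x \<in> {..<m} \<Longrightarrow> card (P `` {x}) = r"
    "\<And>y. y \<in> {m..<2 * m} \<Longrightarrow> card (P\<inverse> `` {y}) = r"
proof -
  define P where "P = {(x, y). x < m \<and> m \<le> y \<and> y < 2 * m \<and> (y - x) mod m < r}"
  \<comment> \<open>An injection from an \<open>m\<close>-element set into \<open>{..<m}\<close> is
    onto, so each value below \<open>r\<close> is taken exactly once.\<close>
  have count: "card {x \<in> S. g x < r} = r"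
    if "finite S" "card S = m" "inj_on g S" "g ` S \<subseteq> {..<m}" for S and g :: "nat \<Rightarrow> nat"
  proof -
    have "g ` S = {..<m}"
      using that by (intro card_subset_eq) (auto simp: card_image)
    moreover have "g ` {x \<in> S. g x < r} = g ` S \<inter> {..<r}" by auto
    ultimately have "g ` {x \<in> S. g x < r} = {..<r}" using assms by auto
    moreover have "inj_on g {x \<in> S. g x < r}" using that by (auto intro: inj_on_subset)
    ultimately show ?thesis using card_image by fastforce
  qed
  have modinj: "a = b" if "a mod m = b mod m" "a < b + m" "b < a + m" for a b
    using that
  proof (induction a b rule: linorder_wlog)
    case (le a b)
    then have "m dvd b - a" by (metis mod_eq_dvd_iff_nat)
    then show ?case using le by (auto dest: dvd_imp_le)
  qed auto
  show ?thesis
  proof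
    show "P \<subseteq> {..<m} \<times> {m..<2 * m}" by (auto simp: P_def)
  next
    fix x assume x: "x \<in> {..<m}"
    have "P `` {x} = {y \<in> {m..<2 * m}. (y - x) mod m < r}" using x by (auto simp: P_def)
    also have "card \<dots> = r"
      using x by (intro count) (auto intro!: inj_onI dest!: modinj)
    finally show "card (P `` {x}) = r" .
  next
    fix y assume y: "y \<in> {m..<2 * m}"
    have "P\<inverse> `` {y} = {x \<in> {..<m}. (y - x) mod m < r}" using y by (auto simp: P_def)
    also have "card \<dots> = r"
      using y by (intro count) (auto intro!: inj_onI dest!: modinj)
    finally show "card (P\<inverse> `` {y}) = r" .
  qed
qed

text \<open>Vertices of both sides are covered by exchanging \<open>A\<close> and \<open>B\<close>.
  The degree bound is recorded for odd n, where a universal vertex turns degrees into extra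
  triangles.\<close>

lemma regular_two_cliques:
  assumes r: "r \<le> m"
  obtains E where "simple_graph {..<2 * m} E" "card E = m * (m - 1) + m * r"
    "\<And>v. v < 2 * m \<Longrightarrow> (m - 1 choose 2) + 3 * (r choose 2) \<le> card (triangles_at E v)"
    "\<And>v. v < 2 * m \<Longrightarrow> m - 1 \<le> card (nbrs E v)"
proof -
  define A B where "A = {..<m}" and "B = {m..<2 * m}"
  obtain P where P: "P \<subseteq> A \<times> B" "\<And>x. x \<in> A \<Longrightarrow> card (P `` {x}) = r"
    "\<And>y. y \<in> B \<Longrightarrow> card (P\<inverse> `` {y}) = r"
    unfolding A_def B_def using regular_bipartite_exists[OF r] by metis
  have AB: "finite A" "finite B" "A \<inter> B = {}" "card A = m" "card B = m" "A \<union> B = {..<2 * m}"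
    by (auto simp: A_def B_def)
  define E where "E = two_cliques A B P"
  have P': "P\<inverse> \<subseteq> B \<times> A" and BA: "B \<inter> A = {}" using P(1) AB(3) by auto
  have E': "two_cliques B A (P\<inverse>) = E" unfolding E_def by (rule two_cliques_swap)
  have G: "simple_graph {..<2 * m} E"
    using simple_graph_two_cliques[OF AB(1-3) P(1)] AB by (simp add: E_def)
  have twice: "2 * (k choose 2) = k * (k - 1)" for k :: nat
    by (cases "even k") (auto simp: choose_two dvd_mult_div_cancel)
  have "finite (P `` {x})" for x
    using AB P by (auto intro!: finite_subset[of _ B])
  then have "card (SIGMA x:A. P `` {x}) = (\<Sum>x\<in>A. card (P `` {x}))"
    using AB by (intro card_SigmaI) auto
  moreover have "(SIGMA x:A. P `` {x}) = P" using P by auto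
  ultimately have "card P = m * r" using P AB by simp
  then have "card E = m * (m - 1) + m * r"
    using card_two_cliques[OF AB(1-3) P(1)] twice[of m] AB by (simp add: E_def)
  moreover have "(m - 1 choose 2) + 3 * (r choose 2) \<le> card (triangles_at E v)
      \<and> m - 1 \<le> card (nbrs E v)" if "v < 2 * m" for v
  proof (cases "v \<in> A")
    case True
    have "A - {v} \<subseteq> nbrs E v"
      using two_cliques_nbrs_left[OF True AB(3) P(1)] by (simp add: E_def)
    then have "card (A - {v}) \<le> card (nbrs E v)" by (rule card_mono[OF finite_nbrs[OF G]])
    then have deg: "m - 1 \<le> card (nbrs E v)" using True AB by simp
    have "(card A - 1 choose 2) + (r choose 2) + r * (r - 1) \<le> card (triangles_at E v)"
      unfolding E_def by (rule two_cliques_triangles_left[OF AB(1-3) P(1) True P(2)[OF True] P(3)])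
    then show ?thesis using deg twice[of r] AB(4) by simp
  next
    case False
    then have v: "v \<in> B" using that AB by auto
    have "B - {v} \<subseteq> nbrs E v"
      using two_cliques_nbrs_left[OF v BA P'] by (simp add: E')
    then have "card (B - {v}) \<le> card (nbrs E v)" by (rule card_mono[OF finite_nbrs[OF G]])
    then have deg: "m - 1 \<le> card (nbrs E v)" using v AB by simp
    have "(card B - 1 choose 2) + (r choose 2) + r * (r - 1) \<le> card (triangles_at E v)"
      using two_cliques_triangles_left[OF AB(2,1) BA P' v P(3)[OF v]] P(2)
      unfolding E' converse_converse by blast
    then show ?thesis using deg twice[of r] AB(5) by simp
  qed
  ultimately show thesis using that G by blast
qed

section \<open>Adding a universal vertex\<close>

text \<open>Each old edge forms a triangle with the apex \<open>u\<close>, and an old vertex gains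
  one triangle through \<open>u\<close> for each of its old neighbours.\<close>

lemma cone_graph:
  assumes G: "simple_graph V E" and u: "u \<notin> V"
  defines "E' \<equiv> E \<union> (\<lambda>x. {u, x}) ` V"
  shows "simple_graph (insert u V) E'" "card E' = card E + card V"
    "card E \<le> card (triangles_at E' u)"
    "\<And>v. v \<in> V \<Longrightarrow> card (triangles_at E v) + card (nbrs E v) \<le> card (triangles_at E' v)"
proof -
  have fV: "finite V" and sub: "\<And>e. e \<in> E \<Longrightarrow> e \<subseteq> V" and fE: "finite E"
    using G finite_edges by (auto simp: simple_graph_def)
  have star: "card ((\<lambda>x. {u, x}) ` W) = card W" "E \<inter> (\<lambda>x. {u, x}) ` W = {}" for W
    using u sub by (auto intro!: card_image inj_onI simp: doubleton_eq_iff)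
  show G': "simple_graph (insert u V) E'"
    using G u by (auto simp: simple_graph_def E'_def card_2_iff')
  show "card E' = card E + card V"
    unfolding E'_def using star fE fV by (simp add: card_Un_disjoint)
  have "E \<subseteq> {e \<in> E'. e \<subseteq> nbrs E' u}" using sub by (auto simp: E'_def nbrs_def)
  then show "card E \<le> card (triangles_at E' u)"
    using finite_edges[OF G'] by (auto simp: card_triangles_at[OF G'] intro: card_mono)
  fix v assume v: "v \<in> V"
  let ?S = "{e \<in> E. e \<subseteq> nbrs E v}" and ?T = "(\<lambda>x. {u, x}) ` nbrs E v"
  have "?S \<inter> ?T = {}" using star by blast
  then have "card (triangles_at E v) + card (nbrs E v) = card (?S \<union> ?T)"
    using star fE finite_nbrs[OF G] by (simp add: card_Un_disjoint card_triangles_at[OF G])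
  also have "?S \<union> ?T \<subseteq> {e \<in> E'. e \<subseteq> nbrs E' v}"
    using v nbrs_subset[OF G, of v] by (auto simp: E'_def nbrs_def insert_commute)
  then have "card (?S \<union> ?T) \<le> card {e \<in> E'. e \<subseteq> nbrs E' v}"
    using finite_edges[OF G'] by (intro card_mono) auto
  finally show "card (triangles_at E v) + card (nbrs E v) \<le> card (triangles_at E' v)"
    by (simp add: card_triangles_at[OF G'])
qed

section \<open>Tightness\<close>

lemma edge_bound_tight_integral:
  assumes adm: "admissible n t r" and int: "real n / 2 \<in> \<int>" "t \<in> \<int>" "r \<in> \<int>"
  shows "\<exists>(V :: nat set) E. triangle_graph n t V E \<and> real (card E) = edge_bound n t r"
proof (cases "n = 0")
  case True
  then have "edge_bound n t r = 0" using edge_bound_0 adm by simp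
  moreover have "triangle_graph n t {} {}"
    using True by (simp add: triangle_graph_def simple_graph_def)
  ultimately show ?thesis by (metis card.empty of_nat_0)
next
  case False
  have nat_Ints: "\<exists>k. x = real k" if "x \<in> \<int>" "0 \<le> x" for x :: real
    using that Ints_cases zero_le_imp_eq_int of_int_0_le_iff of_int_of_nat_eq by metis
  obtain m where m: "real n / 2 = real m" using nat_Ints[OF int(1)] by auto
  then have nm: "n = 2 * m" by linarith
  then have n2: "n \<ge> 2" using False by simp
  have "0 \<le> t" "0 \<le> r" using adm n2 by (auto simp: admissible_def)
  then obtain k q where k: "t = real k" and q: "r = real q"
    using nat_Ints int by metis
  show ?thesis
  proof (cases "r + t \<le> 5 * real n / 6")
    case True
    have "n \<le> 2 * (k + 1)" "k + 1 \<le> n" using adm k by (auto simp: admissible_def)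
    then show ?thesis using overlapping_cliques[of n k t] k True by (simp add: edge_bound_def)
  next
    case False
    \<comment> \<open>Here m = n/2 exactly, so the triangle count of the construction equals
      \<open>t gchoose 2\<close> by the defining equation.\<close>
    have "q \<le> m" using admissible_r_le_half[OF adm n2] q nm by simp
    then obtain E where E: "simple_graph {..<2 * m} E" "card E = m * (m - 1) + m * q"
      "\<And>v. v < 2 * m \<Longrightarrow> (m - 1 choose 2) + 3 * (q choose 2) \<le> card (triangles_at E v)"
      using regular_two_cliques by metis
    have m1: "m \<ge> 1" using nm n2 by simp
    have "t gchoose 2 = real ((m - 1 choose 2) + 3 * (q choose 2))"
      using adm nm m1 by (simp add: admissible_def binomial_gbinomial of_nat_diff q)
    then have "triangle_graph n t {..<2 * m} E"
      using E by (simp add: triangle_graph_def nm del: of_nat_add of_nat_mult)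
    moreover have "real (card E) = real m * (real m + real q - 1)"
      unfolding E(2) using m1 by (simp add: of_nat_diff distrib_left right_diff_distrib)
    then have "real (card E) = edge_bound n t r"
      using False edge_fun_regular[OF adm] by (simp add: edge_bound_def m q)
    ultimately show ?thesis by blast
  qed
qed

text \<open>Rounding \<open>t\<close> up costs at most 2n edges. Rounding \<open>r\<close> up costs
  at most n/2, and the universal vertex for odd n adds n - 1 more, so the constant 2
  suffices.\<close>

lemma edge_bound_tight_linear:
  assumes adm: "admissible n t r" and n2: "n \<ge> 2"
  shows "\<exists>(V :: nat set) E. triangle_graph n t V E \<and> real (card E) \<le> edge_bound n t r + 2 * real n"
proof -
  define k q m where "k = nat \<lceil>t\<rceil>" and "q = nat \<lceil>r\<rceil>" and "m = n div 2"
  have t: "real n / 2 \<le> t + 1" "t + 1 \<le> real n" "0 \<le> t" and r: "0 \<le> r"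
    and eq: "t gchoose 2 = ((real n / 2 - 1) gchoose 2) + 3 * (r gchoose 2)"
    using adm n2 by (auto simp: admissible_def)
  have k: "t \<le> real k" "real k < t + 1" using t(3) ceiling_correct[of t] by (simp_all add: k_def)
  have q: "r \<le> real q" "real q < r + 1" using r ceiling_correct[of r] by (simp_all add: q_def)
  have m1: "m \<ge> 1" using n2 by (simp add: m_def)
  show ?thesis
  proof (cases "r + t \<le> 5 * real n / 6")
    case True
    have "real n \<le> real (2 * (k + 1))" "real k < real n" using t k by simp_all
    then have kn: "n \<le> 2 * (k + 1)" "k + 1 \<le> n" by simp_all
    then have kn': "real k + 1 \<le> real n" by linarith
    have "t gchoose 2 \<le> real k gchoose 2" using gchoose_two_le_nat t k by blast
    with kn obtain V :: "nat set" and E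
      where E: "triangle_graph n t V E" "real (card E) = edge_fun n k k"
      using overlapping_cliques by blast
    \<comment> \<open>Both parameters move here, so \<open>edge_fun_diff\<close> does not apply; the
      first factor is below 1 and the second at most 2n.\<close>
    have "edge_fun n k k - edge_fun n t t = (real k - t) * (2 * real n - 2 - t - real k)"
      unfolding edge_fun_def gchoose_two_real by (simp add: field_simps)
    also have "\<dots> \<le> 1 * (2 * real n)"
      using k t kn' by (intro mult_mono) auto
    finally have "real (card E) \<le> edge_bound n t r + 2 * real n"
      using E True by (simp add: edge_bound_def)
    then show ?thesis using E by blast
  next
    case False
    then have bound: "edge_bound n t r = real n / 2 * (real n / 2 + r - 1)"
      using edge_fun_regular[OF adm] by (simp add: edge_bound_def)
    have rq: "r gchoose 2 \<le> real q gchoose 2" using gchoose_two_le_nat r q by blast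
    show ?thesis
    proof (cases "q \<le> m")
      \<comment> \<open>No \<open>q\<close>-regular bipartite graph fits. But then \<open>r\<close>
        exceeds n/2 - 1, and even the complete graph is within n/2 edges of the bound.\<close>
      case False
      then have "r > m" using q by linarith
      then have r': "r \<ge> real n / 2 - 1" by (simp add: m_def)
      have "t gchoose 2 \<le> real (n - 1) gchoose 2"
        using t n2 by (intro gchoose_two_le_nat) (auto simp: of_nat_diff)
      then obtain V :: "nat set" and E
        where E: "triangle_graph n t V E" "real (card E) = edge_fun n (real (n - 1)) (real (n - 1))"
        using overlapping_cliques[of n "n - 1" t] n2 by auto
      have "real (card E) = real n / 2 * (real n - 1)"
        unfolding E(2) using n2 by (simp add: edge_fun_def gchoose_two_real of_nat_diff field_simps)
      also have "\<dots> \<le> real n / 2 * (real n / 2 + r - 1 + 1)"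
        using r' by (intro mult_left_mono) auto
      finally have "real (card E) \<le> edge_bound n t r + 2 * real n"
        unfolding bound by (simp add: algebra_simps)
      then show ?thesis using E by blast
    next
      case True
      then obtain E where E: "simple_graph {..<2 * m} E" "card E = m * (m - 1) + m * q"
        "\<And>v. v < 2 * m \<Longrightarrow> (m - 1 choose 2) + 3 * (q choose 2) \<le> card (triangles_at E v)"
        "\<And>v. v < 2 * m \<Longrightarrow> m - 1 \<le> card (nbrs E v)"
        using regular_two_cliques by metis
      have tri: "((real m - 1) gchoose 2) + 3 * (real q gchoose 2) \<le> card (triangles_at E v)"
        if "v < 2 * m" for v
      proof -
        have "real ((m - 1 choose 2) + 3 * (q choose 2)) \<le> card (triangles_at E v)"
          using E(3)[OF that] by (simp only: of_nat_le_iff)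
        then show ?thesis using m1 by (simp add: binomial_gbinomial of_nat_diff)
      qed
      have cE: "real (card E) = real m * (real m - 1 + real q)"
        unfolding E(2) using m1 by (simp add: of_nat_diff distrib_left right_diff_distrib)
      have "real m * (real m - 1 + real q) \<le> real n / 2 * (real n / 2 + r - 1 + 1)"
        using q m1 by (intro mult_mono) (auto simp: m_def)
      then have cE': "real (card E) \<le> edge_bound n t r + real n / 2"
        unfolding bound cE by (simp add: algebra_simps)
      show ?thesis
      proof (cases "even n")
        case True
        then have nm: "n = 2 * m" by (simp add: m_def)
        have "triangle_graph n t {..<2 * m} E"
          using E(1) tri eq rq unfolding triangle_graph_def nm by fastforce
        moreover have "real (card E) \<le> edge_bound n t r + 2 * real n" using cE' by simp
        ultimately show ?thesis by blast
      next
        case False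
        then have nm: "n = 2 * m + 1" by (simp add: m_def)
        define E' where "E' = E \<union> (\<lambda>x. {2 * m, x}) ` {..<2 * m}"
        have E': "simple_graph (insert (2 * m) {..<2 * m}) E'" "card E' = card E + 2 * m"
          "card E \<le> card (triangles_at E' (2 * m))"
          "\<And>v. v < 2 * m \<Longrightarrow> card (triangles_at E v) + card (nbrs E v) \<le> card (triangles_at E' v)"
          unfolding E'_def using cone_graph[OF E(1), of "2 * m"] by auto
        \<comment> \<open>Here n/2 - 1 = m - 1/2, and the right side is the binomial of m. The m - 1
          triangles gained through the apex thus make up for rounding n/2 down.\<close>
        have half: "(real n / 2 - 1) gchoose 2 \<le> ((real m - 1) gchoose 2) + real (m - 1)"
          using m1 by (simp add: gchoose_two_real nm of_nat_diff field_simps)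
        have "t gchoose 2 \<le> card (triangles_at E' v)" if v: "v < 2 * m" for v
        proof -
          have "t gchoose 2 \<le> real (card (triangles_at E v)) + real (m - 1)"
            using tri[OF v] half eq rq by linarith
          also have "\<dots> \<le> real (card (triangles_at E v) + card (nbrs E v))"
            using E(4)[OF v] by simp
          also have "\<dots> \<le> card (triangles_at E' v)"
            using E'(4)[OF v] by (simp only: of_nat_le_iff)
          finally show ?thesis .
        qed
        moreover have "t gchoose 2 \<le> card (triangles_at E' (2 * m))"
        proof -
          \<comment> \<open>The apex lies in at least \<open>card E\<close> = m(m-1) + mq triangles.
            Three copies of the binomial of q are at most the binomial of m plus mq, since q(q-1) is
            at most mq.\<close>
          have "real q gchoose 2 \<le> real m gchoose 2" "0 \<le> real q * (real m - real q)"
            using \<open>q \<le> m\<close> by (auto intro: gchoose_two_le_nat)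
          then have "((real m - 1) gchoose 2) + real (m - 1) + 3 * (real q gchoose 2) \<le> card E"
            using m1 unfolding cE gchoose_two_real by (simp add: of_nat_diff field_simps)
          then show ?thesis using E'(3) half eq rq by linarith
        qed
        ultimately have "triangle_graph n t (insert (2 * m) {..<2 * m}) E'"
          using E'(1) unfolding triangle_graph_def nm by auto
        moreover have "real (card E') \<le> edge_bound n t r + 2 * real n"
        proof -
          have "real (card E') = real (card E) + 2 * real m" "real n = 2 * real m + 1"
            using E'(2) nm by simp_all
          then show ?thesis using cE' by linarith
        qed
        ultimately show ?thesis by blast
      qed
    qed
  qed
qed

(* The guard 0 < (t gchoose 2) follows from admissible n t r when n >= 5; it removes only
   degenerate cases with n <= 4, where an edgeless graph may meet the triangle condition.
   The guard n >= 2 is needed because for n = 1 and t < 0 no graph meets that condition. *)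
theorem theorem1p6:
  shows
    "(\<forall>n t r (V :: 'a set) E.
        admissible n t r \<and> 0 < (t gchoose 2) \<and> triangle_graph n t V E
          \<longrightarrow> real (card E) \<ge> edge_bound n t r)
     \<and> (\<forall>n t r.
        admissible n t r \<and> real n / 2 \<in> \<int> \<and> t \<in> \<int> \<and> r \<in> \<int>
          \<longrightarrow> (\<exists>(V :: nat set) E. triangle_graph n t V E \<and> real (card E) = edge_bound n t r))
     \<and> (\<exists>C :: real. \<forall>n t r.
        n \<ge> 2 \<and> admissible n t r
          \<longrightarrow> (\<exists>(V :: nat set) E. triangle_graph n t V E
                 \<and> real (card E) \<le> edge_bound n t r + C * real n))"
  using triangle_graph_edges_ge edge_bound_tight_integral edge_bound_tight_linear by blast

end
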